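(* Let $f,g:\mathbb{R}^N\to\mathbb{R}\cup\{+\infty\}$, $F=f+g$ and $\mathcal{D}=\operatorname{int}(\operatorname{dom} f)$ satisfy assumptions (A1), (A2) of the context, let $x^0\in\operatorname{dom} g$, and let $(x^k)_{k\in\mathbb{N}}$ be the sequence generated by the variable Bregman MM algorithm of the context. Assume moreover: (A3)(a) there exists $\underline{\gamma}>0$ such that, for every $k\in\mathbb{N}$ and every $x\in\operatorname{dom} g$, $Q_f(x,x^k)-f(x)\ge \frac{\gamma_k}{2}\|x-x^k\|^2$ with $\gamma_k\in[\underline{\gamma},+\infty)$; (A3)(b) there exists $\overline{L}>0$ such that, for every $k\in\mathbb{N}$, $\nabla f-\nabla h_{x^k}$ is $L_k$-Lipschitz on every compact subset of $\operatorname{dom} g$, with $L_k\le\overline{L}$. For every $k\in\mathbb{N}$ let $w^{k+1}=\nabla f(x^{k+1})-\nabla Q_f(x^{k+1},x^k)$, where $\nabla Q_f(\cdot,x^k)$ is the gradient with respect to the first variable. Then: (i) for every $k\in\mathbb{N}$, $w^{k+1}\in\partial F(x^{k+1})$; (ii) for every $k\in\mathbb{N}$, $\|w^{k+1}\|\le\overline{L}\,\|x^{k+1}-x^k\|$.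
   Context: $\langle\cdot,\cdot\rangle$ and $\|\cdot\|$ are the Euclidean inner product and norm of $\mathbb{R}^N$; $\operatorname{dom} f=\{x: f(x)<+\infty\}$; $\Gamma_0(\mathbb{R}^N)$ is the set of proper lower semicontinuous convex functions $\mathbb{R}^N\to\mathbb{R}\cup\{+\infty\}$; $\partial$ denotes the limiting subdifferential. Legendre functions. $h\in\Gamma_0(\mathbb{R}^N)$ is essentially smooth if it is differentiable on $\operatorname{int}(\operatorname{dom} h)$ and $\|\nabla h(y^k)\|\to+\infty$ for every sequence $(y^k)$ in $\operatorname{int}(\operatorname{dom} h)$ converging to a boundary point of $\operatorname{dom} h$. It is Legendre if it is essentially smooth and strictly convex on $\operatorname{int}(\operatorname{dom} h)$. $\mathcal{L}(\mathbb{R}^N)$ is the set of Legendre functions. For $h\in\mathcal{L}(\mathbb{R}^N)$ and $(x,y)\in\operatorname{dom} h\times\operatorname{int}(\operatorname{dom} h)$, the Bregman distance is $D_h(x,y)=h(x)-h(y)-\langle\nabla h(y),x-y\rangle$. (A1) (a) $f:\mathbb{R}^N\to\mathbb{R}\cup\{+\infty\}$ is proper, $\mathcal{D}:=\operatorname{int}(\operatorname{dom} f)$ is nonempty and $f$ is continuously differentiable on $\mathcal{D}$. (b) $g:\mathbb{R}^N\to\mathbb{R}\cup\{+\infty\}$ is proper, lower semicontinuous, convex, with $\operatorname{dom} g\subset\mathcal{D}$. (c) $F=f+g$ is coercive, continuous on its domain, and bounded below by some $\underline{F}>-\infty$. (A2) There is a family $(h_z)_{z\in\mathcal{D}}$ in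 $\mathcal{L}(\mathbb{R}^N)$ with $\mathcal{D}\subset\operatorname{int}(\operatorname{dom} h_z)$ for every $z\in\mathcal{D}$ such that, with $Q_f(x,z)=f(z)+\langle\nabla f(z),x-z\rangle+D_{h_z}(x,z)$, one has $f(x)\le Q_f(x,z)$ for all $x,z\in\mathcal{D}$. Algorithm. Starting from $x^0\in\operatorname{dom} g$, for $k=0,1,\dots$: $x^{k+1}=\operatorname{argmin}_{x\in\mathbb{R}^N}\big(Q_f(x,x^k)+g(x)\big)$, where the objective is $+\infty$ outside $\operatorname{dom} g$. (Under (A1), (A2) this minimizer exists, is unique and lies in $\operatorname{dom} g$.) *)

theory Defs
  imports "HOL-Analysis.Analysis"
begin

section \<open>Extended-real-valued functions\<close>

text \<open>Functions with values in the reals extended by \<open>+\<infinity>\<close> are \<^typ>\<open>ereal\<close>-valued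
  functions that never take the value \<open>-\<infinity>\<close>; the latter is part of properness.\<close>

definition edom :: "('a \<Rightarrow> ereal) \<Rightarrow> 'a set" where
  "edom f = {x. f x < \<infinity>}"

definition proper_fun :: "('a \<Rightarrow> ereal) \<Rightarrow> bool" where
  "proper_fun f \<longleftrightarrow> (\<forall>x. f x \<noteq> -\<infinity>) \<and> edom f \<noteq> {}"

definition lsc_fun :: "('a::topological_space \<Rightarrow> ereal) \<Rightarrow> bool" where
  "lsc_fun f \<longleftrightarrow> (\<forall>x. f x \<le> Liminf (at x) f)"

definition convex_fun :: "('a::real_vector \<Rightarrow> ereal) \<Rightarrow> bool" where
  "convex_fun f \<longleftrightarrow> (\<forall>x y t. 0 < t \<and> t < 1 \<longrightarrow>
     f ((1 - t) *\<^sub>R x + t *\<^sub>R y) \<le> ereal (1 - t) * f x + ereal t * f y)"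

definition strictly_convex_fun_on :: "'a::real_vector set \<Rightarrow> ('a \<Rightarrow> ereal) \<Rightarrow> bool" where
  "strictly_convex_fun_on S f \<longleftrightarrow> (\<forall>x\<in>S. \<forall>y\<in>S. \<forall>t. x \<noteq> y \<and> 0 < t \<and> t < 1 \<longrightarrow>
     f ((1 - t) *\<^sub>R x + t *\<^sub>R y) < ereal (1 - t) * f x + ereal t * f y)"

definition Gamma0 :: "('a::euclidean_space \<Rightarrow> ereal) set" where
  "Gamma0 = {f. proper_fun f \<and> lsc_fun f \<and> convex_fun f}"

text \<open>Differentiability and gradients are those of the real part; they are only used at
  interior points of the domain, near which the function is finite.\<close>

definition grad :: "('a::euclidean_space \<Rightarrow> ereal) \<Rightarrow> 'a \<Rightarrow> 'a" where
  "grad f x = (THE v. GDERIV (\<lambda>y. real_of_ereal (f y)) x :> v)"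

definition differentiable_fun_on :: "'a::euclidean_space set \<Rightarrow> ('a \<Rightarrow> ereal) \<Rightarrow> bool" where
  "differentiable_fun_on S f \<longleftrightarrow> (\<forall>x\<in>S. (\<lambda>y. real_of_ereal (f y)) differentiable (at x))"

section \<open>Limiting subdifferential\<close>

definition frechet_subdiff :: "('a::euclidean_space \<Rightarrow> ereal) \<Rightarrow> 'a \<Rightarrow> 'a set" where
  "frechet_subdiff f x = {v. x \<in> edom f \<and>
     0 \<le> Liminf (at x) (\<lambda>y. (f y - f x - ereal (v \<bullet> (y - x))) / ereal (norm (y - x)))}"

definition limiting_subdiff :: "('a::euclidean_space \<Rightarrow> ereal) \<Rightarrow> 'a \<Rightarrow> 'a set" where
  "limiting_subdiff f x = {v. x \<in> edom f \<and>
     (\<exists>y u. y \<longlonglongrightarrow> x \<and> (\<lambda>n. f (y n)) \<longlonglongrightarrow> f x \<and>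
            (\<forall>n. u n \<in> frechet_subdiff f (y n)) \<and> u \<longlonglongrightarrow> v)}"

section \<open>Legendre functions and Bregman distances\<close>

definition essentially_smooth :: "('a::euclidean_space \<Rightarrow> ereal) \<Rightarrow> bool" where
  "essentially_smooth h \<longleftrightarrow> h \<in> Gamma0 \<and>
     differentiable_fun_on (interior (edom h)) h \<and>
     (\<forall>y b. (\<forall>k. y k \<in> interior (edom h)) \<and> b \<in> frontier (edom h) \<and> y \<longlonglongrightarrow> b \<longrightarrow>
        filterlim (\<lambda>k. norm (grad h (y k))) at_top sequentially)"

definition Legendre :: "('a::euclidean_space \<Rightarrow> ereal) set" where
  "Legendre = {h. essentially_smooth h \<and> strictly_convex_fun_on (interior (edom h)) h}"

text \<open>Used for \<open>y\<close> in the interior of the domain of \<open>h\<close>, where \<open>h y\<close> is finite; the value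
  is then \<open>+\<infinity>\<close> when \<open>x\<close> is outside the domain.\<close>

definition bregman :: "('a::euclidean_space \<Rightarrow> ereal) \<Rightarrow> 'a \<Rightarrow> 'a \<Rightarrow> ereal" where
  "bregman h x y = h x - h y - ereal (grad h y \<bullet> (x - y))"

definition Qmaj ::
  "('a::euclidean_space \<Rightarrow> ereal) \<Rightarrow> ('a \<Rightarrow> 'a \<Rightarrow> ereal) \<Rightarrow> 'a \<Rightarrow> 'a \<Rightarrow> ereal" where
  "Qmaj f h x z = f z + ereal (grad f z \<bullet> (x - z)) + bregman (h z) x z"

section \<open>Standing assumptions and the algorithm\<close>

definition assumption_A1 ::
  "('a::euclidean_space \<Rightarrow> ereal) \<Rightarrow> ('a \<Rightarrow> ereal) \<Rightarrow> bool" where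
  "assumption_A1 f g \<longleftrightarrow>
     (let D = interior (edom f); F = (\<lambda>x. f x + g x) in
      (proper_fun f \<and> D \<noteq> {} \<and> differentiable_fun_on D f \<and> continuous_on D (grad f)) \<and>
      (proper_fun g \<and> lsc_fun g \<and> convex_fun g \<and> edom g \<subseteq> D) \<and>
      ((F \<longlongrightarrow> \<infinity>) at_infinity \<and> continuous_on (edom F) F \<and> (\<exists>m::real. \<forall>x. ereal m \<le> F x)))"

definition assumption_A2 ::
  "('a::euclidean_space \<Rightarrow> ereal) \<Rightarrow> ('a \<Rightarrow> 'a \<Rightarrow> ereal) \<Rightarrow> bool" where
  "assumption_A2 f h \<longleftrightarrow>
     (let D = interior (edom f) in
      (\<forall>z\<in>D. h z \<in> Legendre \<and> D \<subseteq> interior (edom (h z))) \<and>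
      (\<forall>x\<in>D. \<forall>z\<in>D. f x \<le> Qmaj f h x z))"

definition variable_bregman_mm ::
  "('a::euclidean_space \<Rightarrow> ereal) \<Rightarrow> ('a \<Rightarrow> ereal) \<Rightarrow> ('a \<Rightarrow> 'a \<Rightarrow> ereal) \<Rightarrow>
   (nat \<Rightarrow> 'a) \<Rightarrow> bool" where
  "variable_bregman_mm f g h x \<longleftrightarrow> x 0 \<in> edom g \<and>
     (\<forall>k. is_arg_min (\<lambda>u. Qmaj f h u (x k) + g u) (\<lambda>_. True) (x (Suc k)))"

end

theory Submission
  imports Defs
begin

text \<open>Minimality of \<open>x\<^sup>k\<^sup>+\<^sup>1\<close> along the segment towards a point of \<open>dom g\<close>, together with the
  convexity of \<open>g\<close>, shows that \<open>-\<nabla>Q\<^sub>f(x\<^sup>k\<^sup>+\<^sup>1, x\<^sup>k)\<close> is a convex subgradient of \<open>g\<close>. Adding the gradient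
  of \<open>f\<close> gives a Frechet, hence limiting, subgradient of \<open>F\<close>. For the bound,
  \<open>w\<^sup>k\<^sup>+\<^sup>1\<close> is the increment of \<open>\<nabla>f - \<nabla>h\<close> between \<open>x\<^sup>k\<close> and \<open>x\<^sup>k\<^sup>+\<^sup>1\<close>, and the Lipschitz assumption
  applies to the two-point compact set they form.\<close>

section \<open>Gradients and finite values of extended-real-valued functions\<close>

text \<open>Makes the definite description in \<open>grad\<close> well determined.\<close>

lemma GDERIV_unique:
  fixes f :: "'a::euclidean_space \<Rightarrow> real"
  assumes "GDERIV f x :> u" "GDERIV f x :> v"
  shows "u = v"
  using has_derivative_unique[OF assms[unfolded gderiv_def]]
  by (metis vector_eq_ldot)

lemma grad_eqI:
  assumes "GDERIV (\<lambda>y. real_of_ereal (f y)) x :> v"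
  shows "grad f x = v"
  unfolding grad_def using assms GDERIV_unique by blast

lemma GDERIV_grad:
  fixes f :: "'a::euclidean_space \<Rightarrow> ereal"
  assumes "differentiable_fun_on S f" "x \<in> S"
  shows "GDERIV (\<lambda>y. real_of_ereal (f y)) x :> grad f x"
proof -
  obtain F where F: "((\<lambda>y. real_of_ereal (f y)) has_derivative F) (at x)"
    using assms unfolding differentiable_fun_on_def differentiable_def by blast
  \<comment> \<open>The derivative is a linear functional; its adjoint at 1 is the Riesz vector
    representing it.\<close>
  have "F = (\<lambda>y. y \<bullet> adjoint F 1)"
    using adjoint_works[OF has_derivative_linear[OF F], where y = 1] by auto
  with F have "GDERIV (\<lambda>y. real_of_ereal (f y)) x :> adjoint F 1"
    unfolding gderiv_def by metis
  then show ?thesis using grad_eqI by metis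
qed

lemma proper_fun_finite:
  assumes "proper_fun f" "x \<in> edom f"
  shows "ereal (real_of_ereal (f x)) = f x"
  using assms unfolding proper_fun_def edom_def by (cases "f x") auto

section \<open>Subgradients of a sum and first-order optimality\<close>

lemma frechet_subdiff_imp_limiting:
  assumes "v \<in> frechet_subdiff f x"
  shows "v \<in> limiting_subdiff f x"
proof -
  have "x \<in> edom f" using assms by (simp add: frechet_subdiff_def)
  then show ?thesis unfolding limiting_subdiff_def mem_Collect_eq using assms
    by (intro conjI exI[of _ "\<lambda>_::nat. x"] exI[of _ "\<lambda>_::nat. v"]) simp_all
qed

text \<open>The global inequality \<open>v\<close> makes the contribution of \<open>g\<close> to the
  difference quotient nonnegative, so the quotient of the sum dominates that of \<open>f\<close>
  alone, which tends to 0 by differentiability.\<close>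

lemma frechet_subdiff_add_smooth:
  fixes f g :: "'a::euclidean_space \<Rightarrow> ereal"
  assumes f: "proper_fun f" "p \<in> interior (edom f)"
    and df: "GDERIV (\<lambda>y. real_of_ereal (f y)) p :> d"
    and g: "proper_fun g" "p \<in> edom g"
    and v: "\<And>u. g p + ereal (v \<bullet> (u - p)) \<le> g u"
  shows "d + v \<in> frechet_subdiff (\<lambda>u. f u + g u) p"
proof -
  define r where "r = (\<lambda>y. real_of_ereal (f y))"
  have fin: "f u = ereal (r u)" if "u \<in> interior (edom f)" for u
    using proper_fun_finite[OF f(1)] that interior_subset unfolding r_def by (metis subsetD)
  obtain a where a: "g p = ereal a" using proper_fun_finite[OF g] by metis
  have "((\<lambda>y. (r y - r p - d \<bullet> (y - p)) / norm (y - p)) \<longlongrightarrow> 0) (at p)"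
    using df unfolding gderiv_def has_derivative_at_within r_def
    by (simp add: inner_commute divide_inverse mult.commute algebra_simps)
  then have ev1: "\<forall>\<^sub>F y in at p. - e < (r y - r p - d \<bullet> (y - p)) / norm (y - p)" if "e > 0" for e
    using that by (simp add: order_tendsto_iff)
  have ev2: "\<forall>\<^sub>F y in at p. y \<in> interior (edom f)"
    using f(2) by (meson eventually_at_topological open_interior)
  have ev3: "\<forall>\<^sub>F y in at p. y \<noteq> p"
    by (simp add: eventually_at_filter)
  have "0 \<le> Liminf (at p) (\<lambda>y. (f y + g y - (f p + g p) - ereal ((d + v) \<bullet> (y - p))) / ereal (norm (y - p)))"
    unfolding le_Liminf_iff
  proof (intro allI impI)
    fix c :: ereal assume "c < 0"
    \<comment> \<open>Since \<open>c\<close> may be -\<infinity>, a real level between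
      \<open>c\<close> and 0 is inserted; it can be compared with the real quotient of
      \<open>f\<close>.\<close>
    then obtain e where e: "e > 0" "c < ereal (- e)"
      by (metis ereal_dense2 ereal_less(5) ereal_less_eq(3) less_ereal.simps(1) minus_minus neg_less_0_iff_less zero_ereal_def)
    show "\<forall>\<^sub>F y in at p. c < (f y + g y - (f p + g p) - ereal ((d + v) \<bullet> (y - p))) / ereal (norm (y - p))"
      using ev1[OF e(1)] ev2 ev3
    proof eventually_elim
      case (elim y)
      have n: "norm (y - p) > 0" using elim by simp
      note v' = v[of y, unfolded a]
      show ?case
      proof (cases "g y")
        case (real b)
        then have "v \<bullet> (y - p) \<le> b - a" using v' by simp
        then have "r y - r p - d \<bullet> (y - p) \<le> r y + b - (r p + a) - (d + v) \<bullet> (y - p)"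
          by (simp add: inner_add_left)
        then have "- e < (r y + b - (r p + a) - (d + v) \<bullet> (y - p)) / norm (y - p)"
          using elim(1) n by (meson divide_right_mono less_le_trans norm_ge_zero)
        then have "ereal (- e) < (f y + g y - (f p + g p) - ereal ((d + v) \<bullet> (y - p))) / ereal (norm (y - p))"
          using n by (simp add: fin[OF elim(2)] fin[OF f(2)] real a)
        then show ?thesis using e(2) by (rule less_trans[rotated])
      next
        \<comment> \<open>Outside the domain of \<open>g\<close> the whole quotient is
          +\<infinity>.\<close>
        case PInf
        then show ?thesis using n e(2)
          by (auto simp: fin[OF elim(2)] fin[OF f(2)] a)
      next
        case MInf
        then show ?thesis using g(1) by (auto simp: proper_fun_def)
      qed
    qed
  qed
  moreover have "p \<in> edom (\<lambda>u. f u + g u)"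
    by (simp add: edom_def fin[OF f(2)] a)
  ultimately show ?thesis by (simp add: frechet_subdiff_def)
qed

text \<open>On the segment from \<open>p\<close> to \<open>u\<close>, convexity bounds
  \<open>g\<close> by its chord, with equality at \<open>p\<close>. So \<open>q\<close> plus the
  chord also attains its minimum at \<open>p\<close> over a short initial piece, and its right
  derivative there, \<open>(u - p) \<bullet> d + (b - a)\<close>, is nonnegative. Only
  \<open>g\<close> has to be convex for this.\<close>

lemma minimizer_subgradient:
  fixes q g :: "'a::euclidean_space \<Rightarrow> ereal"
  assumes q: "proper_fun q" "p \<in> interior (edom q)"
    and dq: "GDERIV (\<lambda>y. real_of_ereal (q y)) p :> d"
    and g: "proper_fun g" "convex_fun g" "p \<in> edom g"
    and min: "\<And>u. q p + g p \<le> q u + g u"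
  shows "g p + ereal (- d \<bullet> (u - p)) \<le> g u"
proof (cases "u \<in> edom g")
  case False
  then show ?thesis by (simp add: edom_def)
next
  case True
  obtain a where a: "g p = ereal a" using proper_fun_finite[OF g(1,3)] by metis
  obtain b where b: "g u = ereal b" using proper_fun_finite[OF g(1) True] by metis
  define r where "r = (\<lambda>y. real_of_ereal (q y))"
  have fin: "q u = ereal (r u)" if "u \<in> interior (edom q)" for u
    using proper_fun_finite[OF q(1)] that interior_subset unfolding r_def by (metis subsetD)
  define s where "s = (\<lambda>t. p + t *\<^sub>R (u - p))"
  \<comment> \<open>This is \<open>q\<close> plus the chord of \<open>g\<close> along the segment,
    with the constant \<open>a\<close> dropped.\<close>
  define \<psi> where "\<psi> = (\<lambda>t. r (s t) + t * (b - a))"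
  have "(r has_derivative (\<lambda>y. y \<bullet> d)) (at (s 0))"
    using dq by (simp add: gderiv_def r_def s_def)
  moreover have "(s has_derivative (\<lambda>t. t *\<^sub>R (u - p))) (at 0)"
    unfolding s_def by (auto intro!: derivative_eq_intros)
  ultimately have "((\<lambda>t. r (s t)) has_derivative (\<lambda>t. (t *\<^sub>R (u - p)) \<bullet> d)) (at 0)"
    using has_derivative_compose by blast
  then have "DERIV (\<lambda>t. r (s t)) 0 :> (u - p) \<bullet> d"
    by (simp add: has_field_derivative_def mult.commute[of _ "(u - p) \<bullet> d"])
  then have D: "DERIV \<psi> 0 :> (u - p) \<bullet> d + (b - a)"
    unfolding \<psi>_def by (auto intro!: derivative_eq_intros)
  \<comment> \<open>Needed so that \<open>q\<close> agrees with its real part \<open>r\<close> for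
    small \<open>t\<close>.\<close>
  have "\<forall>\<^sub>F t in nhds 0. s t \<in> interior (edom q)"
  proof -
    have "isCont s 0" unfolding s_def by (intro continuous_intros)
    then have "filterlim s (nhds (s 0)) (nhds 0)"
      by (simp only: continuous_at tendsto_at_iff_tendsto_nhds)
    then have "filterlim s (nhds p) (nhds 0)" by (simp add: s_def)
    then show ?thesis using eventually_nhds_in_open[OF open_interior q(2)]
      unfolding filterlim_iff by blast
  qed
  then obtain \<delta> where \<delta>: "\<delta> > 0" "\<And>t. \<bar>t\<bar> < \<delta> \<Longrightarrow> s t \<in> interior (edom q)"
    by (auto simp: eventually_nhds_metric dist_real_def)
  have ge: "\<psi> 0 \<le> \<psi> t" if t: "0 < t" "t < 1" "t < \<delta>" for t
  proof -
    have st: "s t = (1 - t) *\<^sub>R p + t *\<^sub>R u" by (simp add: s_def algebra_simps)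
    have "g (s t) \<le> ereal ((1 - t) * a + t * b)"
      using g(2) t unfolding convex_fun_def st by (metis a b plus_ereal.simps(1) times_ereal.simps(1))
    then have "q (s t) + g (s t) \<le> ereal (r (s t)) + ereal ((1 - t) * a + t * b)"
      using fin[OF \<delta>(2)[of t]] t by (simp add: add_left_mono del: plus_ereal.simps)
    then have "ereal (r p) + ereal a \<le> ereal (r (s t)) + ereal ((1 - t) * a + t * b)"
      using min[of "s t", unfolded fin[OF q(2)] a] by (rule order_trans[rotated])
    then have "r p + a \<le> r (s t) + ((1 - t) * a + t * b)" by simp
    moreover have "\<psi> 0 = r p" by (simp add: \<psi>_def s_def)
    moreover have "\<psi> t = r (s t) + (t * b - t * a)" by (simp add: \<psi>_def right_diff_distrib)
    ultimately show ?thesis by (simp add: left_diff_distrib)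
  qed
  have "(u - p) \<bullet> d + (b - a) \<ge> 0"
  proof (rule ccontr)
    assume "\<not> (u - p) \<bullet> d + (b - a) \<ge> 0"
    then have "(u - p) \<bullet> d + (b - a) < 0" by simp
    then obtain \<epsilon> where \<epsilon>: "\<epsilon> > 0" "\<And>t. 0 < t \<Longrightarrow> t < \<epsilon> \<Longrightarrow> \<psi> t < \<psi> 0"
      using has_real_derivative_neg_dec_right[OF D] by auto
    \<comment> \<open>Halving makes \<open>t\<close> strictly smaller than all three bounds: strict
      decrease of \<open>\<psi>\<close>, convexity of the combination, finiteness of
      \<open>q\<close>.\<close>
    define t where "t = min \<epsilon> (min 1 \<delta>) / 2"
    have "0 < t" "t < 1" "t < \<delta>" "t < \<epsilon>" using \<epsilon>(1) \<delta>(1) unfolding t_def by linarith+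
    then show False using \<epsilon>(2)[of t] ge[of t] by linarith
  qed
  then show ?thesis by (simp add: a b inner_commute)
qed

section \<open>The majorant as a function of its first argument\<close>

text \<open>For fixed \<open>z\<close> the majorant is \<open>h z\<close> plus an affine function of
  \<open>u\<close>; its properness, domain and gradient are all read off from this form, which also
  covers infinite \<open>h z u\<close>.\<close>

lemma Qmaj_real:
  assumes "f z = ereal a" "h z z = ereal b"
  shows "Qmaj f h u z = h z u + ereal (a - b + (grad f z - grad (h z) z) \<bullet> (u - z))"
  using assms by (cases "h z u") (auto simp: Qmaj_def bregman_def inner_diff_left)

lemma proper_fun_Qmaj:
  assumes "proper_fun (h z)" "f z = ereal a" "h z z = ereal b"
  shows "proper_fun (\<lambda>u. Qmaj f h u z)" and "edom (\<lambda>u. Qmaj f h u z) = edom (h z)"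
  using assms(1) unfolding Qmaj_real[of f z a h b, OF assms(2,3)] proper_fun_def edom_def by auto

lemma GDERIV_Qmaj:
  fixes h :: "'a::euclidean_space \<Rightarrow> 'a \<Rightarrow> ereal"
  assumes h: "proper_fun (h z)" "p \<in> interior (edom (h z))"
    and dh: "GDERIV (\<lambda>u. real_of_ereal (h z u)) p :> d"
    and z: "f z = ereal a" "h z z = ereal b"
  shows "GDERIV (\<lambda>u. real_of_ereal (Qmaj f h u z)) p :> d + (grad f z - grad (h z) z)"
proof -
  let ?c = "grad f z - grad (h z) z"
  have "((\<lambda>u. real_of_ereal (h z u) + (a - b + ?c \<bullet> (u - z))) has_derivative
      (\<lambda>y. y \<bullet> (d + ?c))) (at p)"
    using dh unfolding gderiv_def
    by (auto intro!: derivative_eq_intros simp: inner_add_right inner_commute)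
  then show ?thesis unfolding gderiv_def
  \<comment> \<open>The two real parts are compared only where \<open>h z\<close> is finite:
    \<open>real_of_ereal\<close> sends \<infinity> to 0, so the affine term would be lost
    elsewhere.\<close>
  proof (rule has_derivative_transform_within_open[OF _ open_interior h(2)])
    fix u assume "u \<in> interior (edom (h z))"
    then have "u \<in> edom (h z)" using interior_subset by blast
    then obtain e where "h z u = ereal e" using proper_fun_finite[OF h(1)] by metis
    then show "real_of_ereal (h z u) + (a - b + ?c \<bullet> (u - z)) = real_of_ereal (Qmaj f h u z)"
      by (simp add: Qmaj_real[of f z a h b, OF z])
  qed
qed

theorem proposition4p3:
  fixes f g :: "real ^ 'n \<Rightarrow> ereal"
    and h :: "real ^ 'n \<Rightarrow> real ^ 'n \<Rightarrow> ereal"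
    and x w :: "nat \<Rightarrow> real ^ 'n"
    and \<gamma> L :: "nat \<Rightarrow> real"
    and \<gamma>_low L_up :: real
  assumes A1: "assumption_A1 f g"
    and A2: "assumption_A2 f h"
    and mm: "variable_bregman_mm f g h x"
    and A3a: "\<gamma>_low > 0" "\<And>k. \<gamma> k \<ge> \<gamma>_low"
      "\<And>k u. u \<in> edom g \<Longrightarrow>
         Qmaj f h u (x k) - f u \<ge> ereal (\<gamma> k / 2 * (norm (u - x k))\<^sup>2)"
    and A3b: "L_up > 0" "\<And>k. L k \<le> L_up"
      "\<And>k K. compact K \<Longrightarrow> K \<subseteq> edom g \<Longrightarrow>
         (L k)-lipschitz_on K (\<lambda>u. grad f u - grad (h (x k)) u)"
    and w: "\<And>k. w (Suc k) = grad f (x (Suc k)) - grad (\<lambda>u. Qmaj f h u (x k)) (x (Suc k))"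
  shows "(\<forall>k. w (Suc k) \<in> limiting_subdiff (\<lambda>u. f u + g u) (x (Suc k))) \<and>
         (\<forall>k. norm (w (Suc k)) \<le> L_up * norm (x (Suc k) - x k))"
proof -
  define D where "D = interior (edom f)"
  have f: "proper_fun f" "differentiable_fun_on D f"
    and g: "proper_fun g" "convex_fun g" and gD: "edom g \<subseteq> D"
    using A1 by (auto simp: assumption_A1_def Let_def D_def)
  have h: "proper_fun (h z)" "differentiable_fun_on (interior (edom (h z))) (h z)"
    "D \<subseteq> interior (edom (h z))" if "z \<in> D" for z
    using A2 that
    by (auto simp: assumption_A2_def Let_def D_def Legendre_def essentially_smooth_def Gamma0_def)
  have min: "Qmaj f h (x (Suc k)) (x k) + g (x (Suc k)) \<le> Qmaj f h u (x k) + g u" for k u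
    using mm by (auto simp: variable_bregman_mm_def is_arg_min_def not_less)
  have fz: "\<exists>a. f z = ereal a" if "z \<in> D" for z
    using proper_fun_finite[OF f(1)] that interior_subset unfolding D_def by (metis subsetD)
  have hz: "\<exists>b. h z z = ereal b" if "z \<in> D" for z
    using proper_fun_finite[OF h(1)[OF that]] h(3)[OF that] that interior_subset by (metis subsetD)
  \<comment> \<open>Feasibility propagates by testing minimality against the previous iterate: the
    majorant equals \<open>f\<close> at its base point, so the objective there is finite, and hence
    so is the minimal value.\<close>
  have xg: "x k \<in> edom g" for k
  proof (induction k)
    case 0
    then show ?case using mm by (simp add: variable_bregman_mm_def)
  next
    case (Suc k)
    let ?q = "\<lambda>u. Qmaj f h u (x k)"
    have z: "x k \<in> D" using Suc gD by blast
    obtain a b where ab: "f (x k) = ereal a" "h (x k) (x k) = ereal b" using fz hz z by metis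
    have "?q (x k) + g (x k) < \<infinity>"
      using Suc by (simp add: Qmaj_real[of f "x k" a h b, OF ab] ab edom_def)
    then have "?q (x (Suc k)) + g (x (Suc k)) < \<infinity>"
      using min[of k "x k"] by (rule le_less_trans[rotated])
    moreover have "?q (x (Suc k)) \<noteq> -\<infinity>"
      using proper_fun_Qmaj(1)[of h "x k" f a b, OF h(1)[OF z] ab] by (auto simp: proper_fun_def)
    ultimately show ?case by (auto simp: edom_def)
  qed
  have main: "w (Suc k) \<in> limiting_subdiff (\<lambda>u. f u + g u) (x (Suc k)) \<and>
      norm (w (Suc k)) \<le> L_up * norm (x (Suc k) - x k)" for k
  proof -
    define z p where "z = x k" and "p = x (Suc k)"
    let ?q = "\<lambda>u. Qmaj f h u z"
    \<comment> \<open>The gradient of \<open>?q\<close> at \<open>p\<close>. Regrouping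
      \<open>grad f p - d\<close> gives the difference of \<open>grad f - grad (h z)\<close> between
      \<open>p\<close> and \<open>z\<close>, the form used for the norm bound.\<close>
    define d where "d = grad (h z) p + (grad f z - grad (h z) z)"
    have zD: "z \<in> D" and pD: "p \<in> D" using xg gD by (auto simp: z_def p_def)
    obtain a b where ab: "f z = ereal a" "h z z = ereal b" using fz hz zD by metis
    note hz = h[OF zD]
    have ph: "p \<in> interior (edom (h z))" using hz(3) pD by blast
    have dq: "GDERIV (\<lambda>u. real_of_ereal (?q u)) p :> d"
      unfolding d_def by (rule GDERIV_Qmaj[of h z p _ f a b, OF hz(1) ph GDERIV_grad[OF hz(2) ph] ab])
    have wd: "w (Suc k) = grad f p + - d"
      using w[of k] grad_eqI[OF dq] by (simp add: p_def z_def)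
    have "g p + ereal (- d \<bullet> (u - p)) \<le> g u" for u
      using minimizer_subgradient[OF proper_fun_Qmaj(1)[of h z f a b, OF hz(1) ab] _ dq g]
        ph proper_fun_Qmaj(2)[of h z f a b, OF hz(1) ab] xg min
      by (auto simp: p_def z_def)
    then have "w (Suc k) \<in> frechet_subdiff (\<lambda>u. f u + g u) p"
      unfolding wd using pD xg
      by (intro frechet_subdiff_add_smooth[OF f(1) _ GDERIV_grad[OF f(2) pD] g(1)])
        (simp_all add: D_def p_def)
    moreover have "norm (w (Suc k)) \<le> L_up * norm (p - z)"
    proof -
      have "(L k)-lipschitz_on {z, p} (\<lambda>u. grad f u - grad (h z) u)"
        using A3b(3)[of "{z, p}" k] xg by (simp add: z_def p_def)
      then have "dist (grad f p - grad (h z) p) (grad f z - grad (h z) z) \<le> L k * dist p z"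
        by (rule lipschitz_onD) auto
      then have "norm (w (Suc k)) \<le> L k * norm (p - z)"
        by (simp add: wd d_def dist_norm algebra_simps)
      also have "\<dots> \<le> L_up * norm (p - z)" using A3b(2) by (simp add: mult_right_mono)
      finally show ?thesis .
    qed
    ultimately show ?thesis using frechet_subdiff_imp_limiting by (auto simp: p_def z_def)
  qed
  then show ?thesis by blast
qed

end
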